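(* Let $(X,d)$ be an unbounded geodesic metric space, regarded as the coarse space $(X,\mathcal{E}_d)$. Then the following statements hold: (i) $X$ admits a 2-selector if and only if $X$ is coarsely equivalent to $\mathbb{N}$ or to $\mathbb{Z}$; (ii) if $X$ admits a linear order compatible with the coarse structure $\mathcal{E}_d$ of $X$, then $X$ is coarsely equivalent to $\mathbb{N}$ or to $\mathbb{Z}$.
   Context: Coarse structures. A family $\mathcal{E}$ of subsets of $X\times X$ is a coarse structure on a set $X$ if: each $E\in\mathcal{E}$ contains the diagonal $\triangle_X=\{(x,x):x\in X\}$; if $E,E'\in\mathcal{E}$ then $E\circ E'\in\mathcal{E}$ and $E^{-1}\in\mathcal{E}$, where $E\circ E'=\{(x,y):\exists z\,((x,z)\in E,\ (z,y)\in E')\}$ and $E^{-1}=\{(y,x):(x,y)\in E\}$; and if $E\in\mathcal{E}$ and $\triangle_X\subseteq E'\subseteq E$ then $E'\in\mathcal{E}$. The pair $(X,\mathcal{E})$ is called a coarse space. For $E\in\mathcal{E}$, $x\in X$, $Y\subseteq X$ put $E[x]=\{y\in X:(x,y)\in E\}$ and $E[Y]=\bigcup_{y\in Y}E[y]$. A subfamily $\mathcal{E}'\subseteq\mathcal{E}$ is a base of $\mathcal{E}$ if each $E\in\mathcal{E}$ is contained in some $E'\in\mathcal{E}'$. A subset $Y\subseteq X$ is bounded if $Y\subseteq E[x]$ for some $E\in\mathcal{E}$ and $x\in X$; the space is unbounded if $X$ is not a bounded subset of itself. Each $Y\subseteq X$ carries the subspace coarse structure $\mathcal{E}|_Y=\{E\cap(Y\times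 Y):E\in\mathcal{E}\}$. The subspace $Y$ is large if $X=E[Y]$ for some $E\in\mathcal{E}$. Maps. A map $f:X\to X'$ between coarse spaces $(X,\mathcal{E})$, $(X',\mathcal{E}')$ is macro-uniform if for every $E\in\mathcal{E}$ there exists $E'\in\mathcal{E}'$ such that $f(E[x])\subseteq E'[f(x)]$ for each $x\in X$. An asymorphism is a bijection $f$ such that $f$ and $f^{-1}$ are macro-uniform. Two coarse spaces are coarsely equivalent if they contain large subspaces that are asymorphic to each other. 2-selectors. For a coarse space $(X,\mathcal{E})$, let $\exp X$ be the set of all non-empty subsets of $X$, endowed with the coarse structure having base $\{\exp E:E\in\mathcal{E}\}$, where $(A,B)\in\exp E$ if and only if $A\subseteq E[B]$ and $B\subseteq E[A]$. Let $[X]^2$ be the set of all two-element subsets of $X$, with the subspace coarse structure inherited from $\exp X$. A 2-selector of $(X,\mathcal{E})$ is a macro-uniform map $f:[X]^2\to X$ such that $f(A)\in A$ for each $A\in[X]^2$. Compatible orders. A linear order $\le$ on $X$ is compatible with the coarse structure $\mathcal{E}$ if for every $E\in\mathcal{E}$ there exists $F\in\mathcal{E}$ such that $E\subseteq F$ and, for all distinct $x,y\in X$ with $y\in X\setminus F[x]$: if $x<y$ then $x'<y$ for each $x'\in E[x]$, and if $y<x$ then $y<x'$ for each $x'\in E[x]$. Metrics and graphs. A metric $d$ on $X$ defines the coarse structure $\mathcal{E}_d$ with base $\{\{(x,y):d(x,y)\le r\}:r>0\}$. A metric space $(X,d)$ is geodesic if for any $x,y\in X$ there is an isometric embedding $f:[0,d(x,y)]\to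 X$ with $f(0)=x$ and $f(d(x,y))=y$. $\mathbb{N}$ and $\mathbb{Z}$ denote the graphs on the sets of natural numbers and of integers, respectively, in which two vertices $a,b$ are adjacent if and only if $|a-b|=1$, regarded as coarse spaces via their path metrics. *)

theory Defs
  imports "HOL-Analysis.Abstract_Metric_Spaces"
begin

text \<open>
  A coarse space is a carrier \<open>X\<close> with a family \<open>\<E>\<close> of relations on \<open>X\<close>.  The set \<open>E[x]\<close>
  is \<open>E `` {x}\<close>, the set \<open>E[Y]\<close> is \<open>E `` Y\<close>, and composition of entourages is \<open>O\<close>.
\<close>

definition coarse_structure :: "'a set \<Rightarrow> 'a rel set \<Rightarrow> bool" where
  "coarse_structure X \<E> \<longleftrightarrow>
     \<E> \<subseteq> Pow (X \<times> X) \<and>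
     (\<forall>E\<in>\<E>. Id_on X \<subseteq> E) \<and>
     (\<forall>E\<in>\<E>. \<forall>E'\<in>\<E>. E O E' \<in> \<E>) \<and>
     (\<forall>E\<in>\<E>. E\<inverse> \<in> \<E>) \<and>
     (\<forall>E\<in>\<E>. \<forall>E'. Id_on X \<subseteq> E' \<and> E' \<subseteq> E \<longrightarrow> E' \<in> \<E>)"

text \<open>
  A coarse structure is determined by any of its bases: it consists of the relations that contain
  the diagonal and lie below a member of the base.
\<close>

definition coarse_from_base :: "'a set \<Rightarrow> 'a rel set \<Rightarrow> 'a rel set" where
  "coarse_from_base X \<B> = {E. Id_on X \<subseteq> E \<and> (\<exists>B\<in>\<B>. E \<subseteq> B)}"

text \<open>Under this definition the empty space is unbounded, as there is no \<open>x\<close> to choose.\<close>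

definition coarse_bounded :: "'a set \<Rightarrow> 'a rel set \<Rightarrow> 'a set \<Rightarrow> bool" where
  "coarse_bounded X \<E> Y \<longleftrightarrow> Y \<subseteq> X \<and> (\<exists>E\<in>\<E>. \<exists>x\<in>X. Y \<subseteq> E `` {x})"

definition coarse_unbounded :: "'a set \<Rightarrow> 'a rel set \<Rightarrow> bool" where
  "coarse_unbounded X \<E> \<longleftrightarrow> \<not> coarse_bounded X \<E> X"

definition subspace_coarse :: "'a rel set \<Rightarrow> 'a set \<Rightarrow> 'a rel set" where
  "subspace_coarse \<E> Y = {E \<inter> (Y \<times> Y) | E. E \<in> \<E>}"

definition large_subspace :: "'a set \<Rightarrow> 'a rel set \<Rightarrow> 'a set \<Rightarrow> bool" where
  "large_subspace X \<E> Y \<longleftrightarrow> Y \<subseteq> X \<and> (\<exists>E\<in>\<E>. X = E `` Y)"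

definition macro_uniform ::
    "'a set \<Rightarrow> 'a rel set \<Rightarrow> 'b set \<Rightarrow> 'b rel set \<Rightarrow> ('a \<Rightarrow> 'b) \<Rightarrow> bool" where
  "macro_uniform X \<E> X' \<E>' f \<longleftrightarrow>
     f \<in> X \<rightarrow> X' \<and> (\<forall>E\<in>\<E>. \<exists>E'\<in>\<E>'. \<forall>x\<in>X. f ` (E `` {x}) \<subseteq> E' `` {f x})"

definition asymorphism ::
    "'a set \<Rightarrow> 'a rel set \<Rightarrow> 'b set \<Rightarrow> 'b rel set \<Rightarrow> ('a \<Rightarrow> 'b) \<Rightarrow> bool" where
  "asymorphism X \<E> X' \<E>' f \<longleftrightarrow>
     bij_betw f X X' \<and> macro_uniform X \<E> X' \<E>' f \<and> macro_uniform X' \<E>' X \<E> (inv_into X f)"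

definition coarsely_equivalent ::
    "'a set \<Rightarrow> 'a rel set \<Rightarrow> 'b set \<Rightarrow> 'b rel set \<Rightarrow> bool" where
  "coarsely_equivalent X \<E> X' \<E>' \<longleftrightarrow>
     (\<exists>Y Y' f. large_subspace X \<E> Y \<and> large_subspace X' \<E>' Y' \<and>
        asymorphism Y (subspace_coarse \<E> Y) Y' (subspace_coarse \<E>' Y') f)"

definition nonempty_subsets :: "'a set \<Rightarrow> 'a set set" where
  "nonempty_subsets X = {A. A \<subseteq> X \<and> A \<noteq> {}}"

definition exp_entourage :: "'a set \<Rightarrow> 'a rel \<Rightarrow> 'a set rel" where
  "exp_entourage X E =
     {(A, B). A \<in> nonempty_subsets X \<and> B \<in> nonempty_subsets X \<and> A \<subseteq> E `` B \<and> B \<subseteq> E `` A}"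

definition exp_coarse :: "'a set \<Rightarrow> 'a rel set \<Rightarrow> 'a set rel set" where
  "exp_coarse X \<E> = coarse_from_base (nonempty_subsets X) (exp_entourage X ` \<E>)"

definition two_subsets :: "'a set \<Rightarrow> 'a set set" where
  "two_subsets X = {A. A \<subseteq> X \<and> card A = 2}"

definition two_selector :: "'a set \<Rightarrow> 'a rel set \<Rightarrow> ('a set \<Rightarrow> 'a) \<Rightarrow> bool" where
  "two_selector X \<E> f \<longleftrightarrow>
     macro_uniform (two_subsets X) (subspace_coarse (exp_coarse X \<E>) (two_subsets X)) X \<E> f \<and>
     (\<forall>A\<in>two_subsets X. f A \<in> A)"

text \<open>
  A linear order is a relation \<open>R\<close> with \<open>linear_order_on X R\<close>, so that \<open>x \<le> y\<close> is
  \<open>(x, y) \<in> R\<close> and \<open>x < y\<close> is \<open>(x, y) \<in> R - Id\<close>.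
\<close>

definition compatible_order :: "'a set \<Rightarrow> 'a rel set \<Rightarrow> 'a rel \<Rightarrow> bool" where
  "compatible_order X \<E> R \<longleftrightarrow>
     linear_order_on X R \<and>
     (\<forall>E\<in>\<E>. \<exists>F\<in>\<E>. E \<subseteq> F \<and>
        (\<forall>x\<in>X. \<forall>y\<in>X. x \<noteq> y \<and> y \<in> X - F `` {x} \<longrightarrow>
           ((x, y) \<in> R - Id \<longrightarrow> (\<forall>x'\<in>E `` {x}. (x', y) \<in> R - Id)) \<and>
           ((y, x) \<in> R - Id \<longrightarrow> (\<forall>x'\<in>E `` {x}. (y, x') \<in> R - Id))))"

definition metric_coarse :: "'a set \<Rightarrow> ('a \<Rightarrow> 'a \<Rightarrow> real) \<Rightarrow> 'a rel set" where
  "metric_coarse M d =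
     coarse_from_base M {{(x, y). x \<in> M \<and> y \<in> M \<and> d x y \<le> r} | r. r > 0}"

definition geodesic_metric :: "'a set \<Rightarrow> ('a \<Rightarrow> 'a \<Rightarrow> real) \<Rightarrow> bool" where
  "geodesic_metric M d \<longleftrightarrow>
     (\<forall>x\<in>M. \<forall>y\<in>M. \<exists>f. f \<in> {0..d x y} \<rightarrow> M \<and>
        (\<forall>s\<in>{0..d x y}. \<forall>t\<in>{0..d x y}. d (f s) (f t) = \<bar>s - t\<bar>) \<and>
        f 0 = x \<and> f (d x y) = y)"

text \<open>
  The path metric of a graph given by its adjacency relation: \<open>(x, y) \<in> R ^^ n\<close> means that
  there is a walk of length \<open>n\<close> from \<open>x\<close> to \<open>y\<close>.  It is meaningful for connected graphs only.
\<close>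

definition path_metric :: "'a rel \<Rightarrow> 'a \<Rightarrow> 'a \<Rightarrow> real" where
  "path_metric R x y = real (LEAST n. (x, y) \<in> R ^^ n)"

definition nat_graph :: "nat rel" where
  "nat_graph = {(a, b). \<bar>int a - int b\<bar> = 1}"

definition int_graph :: "int rel" where
  "int_graph = {(a, b). \<bar>a - b\<bar> = 1}"

abbreviation nat_coarse :: "nat rel set" where
  "nat_coarse \<equiv> metric_coarse UNIV (path_metric nat_graph)"

abbreviation int_coarse :: "int rel set" where
  "int_coarse \<equiv> metric_coarse UNIV (path_metric int_graph)"

lemma coarse_structure_from_base:
  assumes "\<B> \<subseteq> Pow (X \<times> X)" "\<And>B. B \<in> \<B> \<Longrightarrow> Id_on X \<subseteq> B"
    and comp: "\<And>B B'. B \<in> \<B> \<Longrightarrow> B' \<in> \<B> \<Longrightarrow> \<exists>C\<in>\<B>. B O B' \<subseteq> C"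
    and conv: "\<And>B. B \<in> \<B> \<Longrightarrow> \<exists>C\<in>\<B>. B\<inverse> \<subseteq> C"
  shows "coarse_structure X (coarse_from_base X \<B>)"
  unfolding coarse_structure_def
proof (intro conjI ballI)
  show "coarse_from_base X \<B> \<subseteq> Pow (X \<times> X)"
    using assms(1) by (auto simp: coarse_from_base_def)
next
  fix E assume "E \<in> coarse_from_base X \<B>"
  then show "Id_on X \<subseteq> E" by (simp add: coarse_from_base_def)
next
  fix E E' assume E: "E \<in> coarse_from_base X \<B>" "E' \<in> coarse_from_base X \<B>"
  then obtain B B' where B: "B \<in> \<B>" "B' \<in> \<B>" "E \<subseteq> B" "E' \<subseteq> B'"
    by (auto simp: coarse_from_base_def)
  then obtain C where C: "C \<in> \<B>" "B O B' \<subseteq> C" using comp by blast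
  have "E O E' \<subseteq> C" using B C by blast
  moreover have "Id_on X \<subseteq> E O E'" using E by (fastforce simp: coarse_from_base_def)
  ultimately show "E O E' \<in> coarse_from_base X \<B>"
    using C by (auto simp: coarse_from_base_def)
next
  fix E assume E: "E \<in> coarse_from_base X \<B>"
  then obtain B where B: "B \<in> \<B>" "E \<subseteq> B" by (auto simp: coarse_from_base_def)
  then obtain C where C: "C \<in> \<B>" "B\<inverse> \<subseteq> C" using conv by blast
  have "E\<inverse> \<subseteq> C" using B C by blast
  moreover have "Id_on X \<subseteq> E\<inverse>" using E by (fastforce simp: coarse_from_base_def)
  ultimately show "E\<inverse> \<in> coarse_from_base X \<B>"
    using C by (auto simp: coarse_from_base_def)
next
  fix E assume E: "E \<in> coarse_from_base X \<B>"
  then show "\<forall>E'. Id_on X \<subseteq> E' \<and> E' \<subseteq> E \<longrightarrow> E' \<in> coarse_from_base X \<B>"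
    unfolding coarse_from_base_def by blast
qed

lemma coarse_structure_metric:
  assumes "Metric_space M d"
  shows "coarse_structure M (metric_coarse M d)"
proof -
  interpret Metric_space M d by fact
  let ?B = "\<lambda>r. {(x, y). x \<in> M \<and> y \<in> M \<and> d x y \<le> r}"
  have comp: "?B r O ?B s \<subseteq> ?B (r + s)" for r s
    using triangle by fastforce
  have conv: "(?B r)\<inverse> \<subseteq> ?B r" for r
    using commute by auto
  show ?thesis
    unfolding metric_coarse_def
  proof (rule coarse_structure_from_base)
    fix B B' assume "B \<in> {?B r | r. r > 0}" "B' \<in> {?B r | r. r > 0}"
    then obtain r s where "r > 0" "s > 0" and B: "B = ?B r" "B' = ?B s" by blast
    then have "?B (r + s) \<in> {?B r | r. r > 0}" using add_pos_pos by blast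
    then show "\<exists>C\<in>{?B r | r. r > 0}. B O B' \<subseteq> C" using comp unfolding B by meson
  next
    fix B assume "B \<in> {?B r | r. r > 0}"
    then show "\<exists>C\<in>{?B r | r. r > 0}. B\<inverse> \<subseteq> C" using conv by blast
  qed auto
qed

lemma coarse_structureD:
  assumes "coarse_structure X \<E>" "E \<in> \<E>"
  shows "E \<subseteq> X \<times> X" "Id_on X \<subseteq> E" "E\<inverse> \<in> \<E>"
    and "\<And>E'. E' \<in> \<E> \<Longrightarrow> E O E' \<in> \<E>"
    and "\<And>E'. Id_on X \<subseteq> E' \<Longrightarrow> E' \<subseteq> E \<Longrightarrow> E' \<in> \<E>"
proof -
  note C = assms(1)[unfolded coarse_structure_def]
  show "E \<subseteq> X \<times> X" using subsetD[OF conjunct1[OF C] assms(2)] by (rule PowD)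
  show "Id_on X \<subseteq> E" by (rule bspec[OF conjunct1[OF conjunct2[OF C]] assms(2)])
  show "E O E' \<in> \<E>" if "E' \<in> \<E>" for E'
    by (rule bspec[OF bspec[OF conjunct1[OF conjunct2[OF conjunct2[OF C]]] assms(2)] that])
  show "E\<inverse> \<in> \<E>"
    by (rule bspec[OF conjunct1[OF conjunct2[OF conjunct2[OF conjunct2[OF C]]]] assms(2)])
  show "E' \<in> \<E>" if "Id_on X \<subseteq> E'" "E' \<subseteq> E" for E'
    by (rule mp[OF spec[OF bspec[OF conjunct2[OF conjunct2[OF conjunct2[OF conjunct2[OF C]]]]
            assms(2)]] conjI[OF that]])
qed

lemma coarse_structure_subspace:
  assumes \<E>: "coarse_structure X \<E>" and "Y \<subseteq> X"
  shows "coarse_structure Y (subspace_coarse \<E> Y)"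
proof -
  have sub: "D \<in> subspace_coarse \<E> Y"
    if "E \<in> \<E>" "Id_on Y \<subseteq> D" "D \<subseteq> E" "D \<subseteq> Y \<times> Y" for D E
  proof -
    have "Id_on X \<subseteq> E" using coarse_structureD(2)[OF \<E>] that by simp
    then have "D \<union> Id_on X \<in> \<E>"
      using that by (intro coarse_structureD(5)[OF \<E> \<open>E \<in> \<E>\<close>]) auto
    moreover have "D = (D \<union> Id_on X) \<inter> (Y \<times> Y)" using that by auto
    ultimately show ?thesis unfolding subspace_coarse_def by blast
  qed
  have diag: "Id_on Y \<subseteq> D" if D: "D \<in> subspace_coarse \<E> Y" for D
  proof -
    obtain E where E: "E \<in> \<E>" "D = E \<inter> (Y \<times> Y)" using D unfolding subspace_coarse_def by blast
    show ?thesis using coarse_structureD(2)[OF \<E> E(1)] \<open>Y \<subseteq> X\<close> unfolding E by auto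
  qed
  have ex: "\<exists>E\<in>\<E>. D \<subseteq> E \<and> D \<subseteq> Y \<times> Y" if "D \<in> subspace_coarse \<E> Y" for D
    using that unfolding subspace_coarse_def by blast
  show ?thesis
    unfolding coarse_structure_def
  proof (intro conjI ballI allI impI)
    show "subspace_coarse \<E> Y \<subseteq> Pow (Y \<times> Y)" using ex by blast
  next
    fix D assume "D \<in> subspace_coarse \<E> Y"
    then show "Id_on Y \<subseteq> D" by (rule diag)
  next
    fix D D' assume D: "D \<in> subspace_coarse \<E> Y" "D' \<in> subspace_coarse \<E> Y"
    then obtain E E' where E: "E \<in> \<E>" "E' \<in> \<E>" "D \<subseteq> E" "D' \<subseteq> E'" "D \<subseteq> Y \<times> Y" "D' \<subseteq> Y \<times> Y"
      using ex by meson
    have "E O E' \<in> \<E>" using E by (intro coarse_structureD(4)[OF \<E>])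
    moreover have "Id_on Y \<subseteq> D O D'" using diag[OF D(1)] diag[OF D(2)] by blast
    ultimately show "D O D' \<in> subspace_coarse \<E> Y" by (rule sub) (use E in blast)+
  next
    fix D assume D: "D \<in> subspace_coarse \<E> Y"
    then obtain E where E: "E \<in> \<E>" "D \<subseteq> E" "D \<subseteq> Y \<times> Y" using ex by meson
    have "E\<inverse> \<in> \<E>" using E by (intro coarse_structureD(3)[OF \<E>])
    moreover have "Id_on Y \<subseteq> D\<inverse>" using diag[OF D] by blast
    ultimately show "D\<inverse> \<in> subspace_coarse \<E> Y" by (rule sub) (use E in blast)+
  next
    fix D D' assume D: "D \<in> subspace_coarse \<E> Y" and D': "Id_on Y \<subseteq> D' \<and> D' \<subseteq> D"
    then obtain E where E: "E \<in> \<E>" "D \<subseteq> E" "D \<subseteq> Y \<times> Y" using ex by meson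
    then show "D' \<in> subspace_coarse \<E> Y" using D' by (intro sub) auto
  qed
qed

lemma coarse_structure_exp:
  assumes \<E>: "coarse_structure X \<E>"
  shows "coarse_structure (nonempty_subsets X) (exp_coarse X \<E>)"
  unfolding exp_coarse_def
proof (rule coarse_structure_from_base)
  show "exp_entourage X ` \<E> \<subseteq> Pow (nonempty_subsets X \<times> nonempty_subsets X)"
    by (auto simp: exp_entourage_def)
next
  fix B assume "B \<in> exp_entourage X ` \<E>"
  then obtain E where E: "E \<in> \<E>" "B = exp_entourage X E" by blast
  then have "Id_on X \<subseteq> E" using coarse_structureD(2)[OF \<E>] by simp
  then show "Id_on (nonempty_subsets X) \<subseteq> B"
    unfolding E exp_entourage_def nonempty_subsets_def by blast
  have "B\<inverse> \<subseteq> B" unfolding E exp_entourage_def by blast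
  then show "\<exists>C\<in>exp_entourage X ` \<E>. B\<inverse> \<subseteq> C" using E by blast
next
  fix B B' assume "B \<in> exp_entourage X ` \<E>" "B' \<in> exp_entourage X ` \<E>"
  then obtain E E' where E: "E \<in> \<E>" "B = exp_entourage X E" "E' \<in> \<E>" "B' = exp_entourage X E'"
    by blast
  let ?F = "(E O E') O (E' O E)"
  have F: "?F \<in> \<E>" using E by (intro coarse_structureD(4)[OF \<E>])
  have id: "Id_on X \<subseteq> E" "Id_on X \<subseteq> E'" "E \<subseteq> X \<times> X" "E' \<subseteq> X \<times> X"
    using coarse_structureD(1,2)[OF \<E>] E by simp_all
  have "Id_on X \<subseteq> E O E'" "Id_on X \<subseteq> E' O E" using id by blast+
  moreover have "E O E' \<subseteq> X \<times> X" "E' O E \<subseteq> X \<times> X" using id by blast+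
  ultimately have sub: "E O E' \<subseteq> ?F" "E' O E \<subseteq> ?F" by blast+
  have "B O B' \<subseteq> exp_entourage X ?F"
  proof
    fix p assume "p \<in> B O B'"
    then obtain A D C where p: "p = (A, C)" and AD: "(A, D) \<in> B" and DC: "(D, C) \<in> B'"
      by (elim relcompE)
    have 1: "A \<subseteq> E `` D" "D \<subseteq> E `` A" "A \<in> nonempty_subsets X"
      using AD unfolding E exp_entourage_def by simp_all
    have 2: "D \<subseteq> E' `` C" "C \<subseteq> E' `` D" "C \<in> nonempty_subsets X"
      using DC unfolding E exp_entourage_def by simp_all
    have "A \<subseteq> E `` (E' `` C)"
      by (rule subset_trans[OF 1(1) Image_mono[OF subset_refl 2(1)]])
    also have "\<dots> = (E' O E) `` C" by (rule relcomp_Image[symmetric])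
    also have "\<dots> \<subseteq> ?F `` C" by (rule Image_mono[OF sub(2) subset_refl])
    finally have 3: "A \<subseteq> ?F `` C" .
    have "C \<subseteq> E' `` (E `` A)"
      by (rule subset_trans[OF 2(2) Image_mono[OF subset_refl 1(2)]])
    also have "\<dots> = (E O E') `` A" by (rule relcomp_Image[symmetric])
    also have "\<dots> \<subseteq> ?F `` A" by (rule Image_mono[OF sub(1) subset_refl])
    finally have "C \<subseteq> ?F `` A" .
    with 1(3) 2(3) 3 show "p \<in> exp_entourage X ?F"
      unfolding p exp_entourage_def by blast
  qed
  then show "\<exists>C\<in>exp_entourage X ` \<E>. B O B' \<subseteq> C" using F by blast
qed

lemma int_graph_walk_bound: "(a, b) \<in> int_graph ^^ n \<Longrightarrow> \<bar>a - b\<bar> \<le> int n"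
  by (induction n arbitrary: b) (force simp: int_graph_def)+

lemma int_graph_walk_up: "(a, a + int n) \<in> int_graph ^^ n"
  by (induction n) (auto simp: int_graph_def relcomp_unfold)

lemma int_graph_walk_down: "(a, a - int n) \<in> int_graph ^^ n"
  by (induction n) (auto simp: int_graph_def relcomp_unfold)

lemma path_metric_int: "path_metric int_graph a b = \<bar>real_of_int a - real_of_int b\<bar>"
proof -
  have "(LEAST n. (a, b) \<in> int_graph ^^ n) = nat \<bar>a - b\<bar>"
  proof (rule Least_equality)
    show "(a, b) \<in> int_graph ^^ nat \<bar>a - b\<bar>"
      using int_graph_walk_up[of a "nat \<bar>a - b\<bar>"] int_graph_walk_down[of a "nat \<bar>a - b\<bar>"]
      by (cases "a \<le> b") auto
  qed (use int_graph_walk_bound in fastforce)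
  then show ?thesis by (simp add: path_metric_def)
qed

lemma nat_graph_walk_bound: "(a, b) \<in> nat_graph ^^ n \<Longrightarrow> \<bar>int a - int b\<bar> \<le> int n"
  by (induction n arbitrary: b) (force simp: nat_graph_def)+

lemma nat_graph_walk_up: "(a, a + n) \<in> nat_graph ^^ n"
  by (induction n) (auto simp: nat_graph_def relcomp_unfold)

lemma nat_graph_walk_down: "(a + n, a) \<in> nat_graph ^^ n"
proof (induction n)
  case (Suc n)
  have "(a + Suc n, a + n) \<in> nat_graph" by (simp add: nat_graph_def)
  then show ?case using Suc relpow_Suc_I2 by metis
qed simp

lemma path_metric_nat: "path_metric nat_graph a b = \<bar>real a - real b\<bar>"
proof -
  have "(LEAST n. (a, b) \<in> nat_graph ^^ n) = nat \<bar>int a - int b\<bar>"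
  proof (rule Least_equality)
    show "(a, b) \<in> nat_graph ^^ nat \<bar>int a - int b\<bar>"
    proof (cases "a \<le> b")
      case True
      then show ?thesis using nat_graph_walk_up[of a "b - a"] by (simp add: nat_diff_distrib)
    next
      case False
      then show ?thesis using nat_graph_walk_down[of b "a - b"] by (simp add: nat_diff_distrib)
    qed
  qed (use nat_graph_walk_bound in fastforce)
  then show ?thesis unfolding path_metric_def by simp
qed

end

theory Submission
  imports Defs
begin

text \<open>
  A 2-selector \<open>f\<close> makes \<open>X\<close> a tournament: \<open>x < y\<close> when \<open>f {x, y} = x\<close>.  Macro-uniformity at
  scale 1 says that there is a constant \<open>s\<close> such that the sign of \<open>x\<close> against \<open>y\<close> does not change
  when \<open>x\<close> makes a step of length at most 1 outside the ball of radius \<open>s\<close> around \<open>y\<close>.  A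
  compatible linear order has the same property, so both parts of the theorem are about such
  tournaments.

  If \<open>x < y < z\<close>, then a geodesic from \<open>x\<close> to \<open>z\<close> starts below \<open>y\<close> and ends above \<open>y\<close>, hence it
  meets the ball of radius \<open>s\<close> around \<open>y\<close>, and
  \<open>d x y + d y z \<le> d x z + 2 * s\<close> (lemma \<open>crossing\<close>).  Fix a base point \<open>p\<close> and let
  \<open>\<phi> x = \<plusminus> d p x\<close>, with the sign of \<open>x\<close> against \<open>p\<close>.  Of two points above \<open>p\<close> one
  is below the other, say \<open>p < x < z\<close>, and crossing at \<open>x\<close> bounds \<open>d x z\<close> by
  \<open>\<phi> z - \<phi> x + 2 * s\<close>.  For \<open>x < p < z\<close>, crossing at \<open>p\<close> bounds \<open>\<phi> z - \<phi> x\<close> by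
  \<open>d x z + 2 * s\<close>.  The remaining estimates are triangle inequalities, up to reversing the tournament,
  so \<open>\<phi>\<close> preserves distances up to \<open>2 * s\<close> (lemmas \<open>signed_dist_upper\<close> and \<open>signed_dist_lower\<close>).
  Following geodesics from \<open>p\<close>, one sees that \<open>\<phi>\<close> attains all large positive values or has an upper
  bound, and likewise for negative values.  Since \<open>X\<close> is unbounded, the image of \<open>\<phi>\<close> is coarsely a
  line or a half-line.

  Conversely, a coarse equivalence with \<open>\<nat>\<close> or \<open>\<int>\<close> yields a coarse embedding \<open>\<psi>\<close> of \<open>X\<close> into
  the reals, and choosing from a pair the point with the smaller value of \<open>\<psi>\<close> is a 2-selector, because
  the minimum of a set of reals moves by at most the Hausdorff distance.
\<close>

section \<open>Metric descriptions of the coarse notions\<close>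

lemma metric_coarse_iff:
  "E \<in> metric_coarse M d \<longleftrightarrow>
     Id_on M \<subseteq> E \<and> E \<subseteq> M \<times> M \<and> (\<exists>r>0. \<forall>x y. (x, y) \<in> E \<longrightarrow> d x y \<le> r)"
proof
  assume "E \<in> metric_coarse M d"
  then obtain r where "r > 0" "Id_on M \<subseteq> E" "E \<subseteq> {(x, y). x \<in> M \<and> y \<in> M \<and> d x y \<le> r}"
    unfolding metric_coarse_def coarse_from_base_def by blast
  then show "Id_on M \<subseteq> E \<and> E \<subseteq> M \<times> M \<and> (\<exists>r>0. \<forall>x y. (x, y) \<in> E \<longrightarrow> d x y \<le> r)"
    by blast
next
  assume R: "Id_on M \<subseteq> E \<and> E \<subseteq> M \<times> M \<and> (\<exists>r>0. \<forall>x y. (x, y) \<in> E \<longrightarrow> d x y \<le> r)"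
  then obtain r where "r > 0" "E \<subseteq> {(x, y). x \<in> M \<and> y \<in> M \<and> d x y \<le> r}" by blast
  then show "E \<in> metric_coarse M d"
    using R unfolding metric_coarse_def coarse_from_base_def by blast
qed

lemma ball_entourage:
  assumes "Metric_space M d" "r > 0"
  shows "{(x, y). x \<in> M \<and> y \<in> M \<and> d x y \<le> r} \<in> metric_coarse M d"
proof -
  interpret Metric_space M d by fact
  show ?thesis using assms(2) unfolding metric_coarse_iff by auto
qed

lemma subspace_metric_coarse:
  assumes "Metric_space X d" "Y \<subseteq> X"
  shows "subspace_coarse (metric_coarse X d) Y = metric_coarse Y d"
proof -
  interpret Metric_space X d by fact
  show ?thesis
  proof (intro equalityI subsetI)
    fix D assume "D \<in> subspace_coarse (metric_coarse X d) Y"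
    then obtain E where E: "E \<in> metric_coarse X d" "D = E \<inter> (Y \<times> Y)"
      unfolding subspace_coarse_def by blast
    have "Id_on Y \<subseteq> D" using E assms(2) unfolding metric_coarse_iff by blast
    then show "D \<in> metric_coarse Y d"
      using E unfolding metric_coarse_iff by blast
  next
    fix D assume D: "D \<in> metric_coarse Y d"
    then obtain r where r: "r > 0" "\<And>x y. (x, y) \<in> D \<Longrightarrow> d x y \<le> r"
      unfolding metric_coarse_iff by blast
    have "D \<union> Id_on X \<in> metric_coarse X d"
      unfolding metric_coarse_iff
    proof (intro conjI exI[of _ r])
      show "\<forall>x y. (x, y) \<in> D \<union> Id_on X \<longrightarrow> d x y \<le> r"
        using r by auto
    qed (use D assms(2) r in \<open>auto simp: metric_coarse_iff\<close>)
    moreover have "D = (D \<union> Id_on X) \<inter> (Y \<times> Y)"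
      using D unfolding metric_coarse_iff by auto
    ultimately show "D \<in> subspace_coarse (metric_coarse X d) Y"
      unfolding subspace_coarse_def by blast
  qed
qed

lemma macro_uniformE:
  assumes "macro_uniform X \<E> X' \<E>' f" "E \<in> \<E>"
  obtains E' where "E' \<in> \<E>'" "\<And>x y. x \<in> X \<Longrightarrow> (x, y) \<in> E \<Longrightarrow> (f x, f y) \<in> E'"
proof -
  have "\<exists>E'\<in>\<E>'. \<forall>x\<in>X. f ` (E `` {x}) \<subseteq> E' `` {f x}"
    using assms by (simp add: macro_uniform_def)
  then obtain E' where E': "E' \<in> \<E>'" "\<And>x. x \<in> X \<Longrightarrow> f ` (E `` {x}) \<subseteq> E' `` {f x}" by blast
  show thesis
  proof (rule that[OF E'(1)])
    fix x y assume "x \<in> X" "(x, y) \<in> E"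
    then show "(f x, f y) \<in> E'" using E'(2)[of x] by blast
  qed
qed

lemma macro_uniform_metric_iff:
  assumes "Metric_space X d" "Metric_space X' d'"
  shows "macro_uniform X (metric_coarse X d) X' (metric_coarse X' d') f \<longleftrightarrow>
     f \<in> X \<rightarrow> X' \<and> (\<forall>r>0. \<exists>s>0. \<forall>x\<in>X. \<forall>y\<in>X. d x y \<le> r \<longrightarrow> d' (f x) (f y) \<le> s)"
    (is "?L \<longleftrightarrow> ?R")
proof
  assume L: ?L
  show ?R
  proof (intro conjI allI impI)
    show "f \<in> X \<rightarrow> X'" using L by (simp add: macro_uniform_def)
    fix r :: real assume "r > 0"
    obtain E' where E': "E' \<in> metric_coarse X' d'"
      "\<And>x y. x \<in> X \<Longrightarrow> (x, y) \<in> {(x, y). x \<in> X \<and> y \<in> X \<and> d x y \<le> r} \<Longrightarrow> (f x, f y) \<in> E'"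
      by (rule macro_uniformE[OF L ball_entourage[OF assms(1) \<open>r > 0\<close>]]) (rule that)
    obtain s where "s > 0" "\<And>x y. (x, y) \<in> E' \<Longrightarrow> d' x y \<le> s"
      using E'(1) unfolding metric_coarse_iff by blast
    moreover have "(f x, f y) \<in> E'" if "x \<in> X" "y \<in> X" "d x y \<le> r" for x y
      by (rule E'(2)) (use that in auto)
    ultimately show "\<exists>s>0. \<forall>x\<in>X. \<forall>y\<in>X. d x y \<le> r \<longrightarrow> d' (f x) (f y) \<le> s" by blast
  qed
next
  assume R: ?R
  show ?L
    unfolding macro_uniform_def
  proof (intro conjI ballI)
    show f: "f \<in> X \<rightarrow> X'" using R by blast
    fix E assume E: "E \<in> metric_coarse X d"
    then obtain r where r: "r > 0" "\<And>x y. (x, y) \<in> E \<Longrightarrow> d x y \<le> r" "E \<subseteq> X \<times> X"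
      unfolding metric_coarse_iff by blast
    obtain s where s: "s > 0" "\<And>x y. x \<in> X \<Longrightarrow> y \<in> X \<Longrightarrow> d x y \<le> r \<Longrightarrow> d' (f x) (f y) \<le> s"
      using R r(1) by blast
    show "\<exists>E'\<in>metric_coarse X' d'. \<forall>x\<in>X. f ` (E `` {x}) \<subseteq> E' `` {f x}"
    proof (intro bexI[OF _ ball_entourage[OF assms(2) s(1)]] ballI subsetI)
      fix x z assume "x \<in> X" "z \<in> f ` (E `` {x})"
      then obtain y where "(x, y) \<in> E" "z = f y" by blast
      moreover from this have "x \<in> X" "y \<in> X" "d x y \<le> r" using r by blast+
      ultimately show "z \<in> {(x, y). x \<in> X' \<and> y \<in> X' \<and> d' x y \<le> s} `` {f x}"
        using s(2) f by blast
    qed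
  qed
qed

definition hausdorff_within :: "('a \<Rightarrow> 'a \<Rightarrow> real) \<Rightarrow> real \<Rightarrow> 'a set \<Rightarrow> 'a set \<Rightarrow> bool" where
  "hausdorff_within d r A B \<longleftrightarrow> (\<forall>a\<in>A. \<exists>b\<in>B. d a b \<le> r) \<and> (\<forall>b\<in>B. \<exists>a\<in>A. d a b \<le> r)"

lemma two_selector_metric_iff:
  assumes "Metric_space X d"
  shows "two_selector X (metric_coarse X d) f \<longleftrightarrow>
     (\<forall>A\<in>two_subsets X. f A \<in> A) \<and>
     (\<forall>r>0. \<exists>s>0. \<forall>A\<in>two_subsets X. \<forall>B\<in>two_subsets X.
        hausdorff_within d r A B \<longrightarrow> d (f A) (f B) \<le> s)"
    (is "?L \<longleftrightarrow> ?R")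
proof -
  interpret Metric_space X d by fact
  have two: "A \<in> nonempty_subsets X" if "A \<in> two_subsets X" for A
    using that unfolding two_subsets_def nonempty_subsets_def by auto
  show ?thesis
  proof
    assume L: ?L
    show ?R
    proof (intro conjI allI impI)
      show "\<forall>A\<in>two_subsets X. f A \<in> A" using L by (simp add: two_selector_def)
      fix r :: real assume r: "r > 0"
      let ?E = "{(x, y). x \<in> X \<and> y \<in> X \<and> d x y \<le> r}"
      let ?D = "exp_entourage X ?E \<inter> (two_subsets X \<times> two_subsets X)"
      have E: "?E \<in> metric_coarse X d" by (rule ball_entourage[OF assms r])
      have "Id_on (nonempty_subsets X) \<subseteq> exp_entourage X ?E"
      proof -
        have "A \<subseteq> ?E `` A" if "A \<subseteq> X" for A
          using that r by (force simp: Image_def)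
        then show ?thesis unfolding exp_entourage_def nonempty_subsets_def by auto
      qed
      with E have "exp_entourage X ?E \<in> exp_coarse X (metric_coarse X d)"
        unfolding exp_coarse_def coarse_from_base_def by blast
      then have "?D \<in> subspace_coarse (exp_coarse X (metric_coarse X d)) (two_subsets X)"
        unfolding subspace_coarse_def by blast
      with L obtain E' where E': "E' \<in> metric_coarse X d"
        "\<And>A B. A \<in> two_subsets X \<Longrightarrow> (A, B) \<in> ?D \<Longrightarrow> (f A, f B) \<in> E'"
        unfolding two_selector_def by (elim conjE macro_uniformE) auto
      obtain s where s: "s > 0" "\<And>x y. (x, y) \<in> E' \<Longrightarrow> d x y \<le> s"
        using E'(1) unfolding metric_coarse_iff by blast
      have "d (f A) (f B) \<le> s"
        if AB: "A \<in> two_subsets X" "B \<in> two_subsets X"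
          and close: "hausdorff_within d r A B" for A B
      proof -
        have ab: "\<forall>a\<in>A. \<exists>b\<in>B. d a b \<le> r" and ba: "\<forall>b\<in>B. \<exists>a\<in>A. d a b \<le> r"
          using close unfolding hausdorff_within_def by blast+
        have sub: "A \<subseteq> X" "B \<subseteq> X" using AB by (auto simp: two_subsets_def)
        have "A \<subseteq> ?E `` B"
        proof
          fix a assume a: "a \<in> A"
          then obtain b where "b \<in> B" "d a b \<le> r" using ab by blast
          then have "(b, a) \<in> ?E" using a sub by (auto simp: commute)
          then show "a \<in> ?E `` B" using \<open>b \<in> B\<close> by blast
        qed
        moreover have "B \<subseteq> ?E `` A" using ba sub by blast
        ultimately have "(A, B) \<in> ?D"
          unfolding exp_entourage_def using AB two by blast
        then have "(f A, f B) \<in> E'" by (rule E'(2)[OF AB(1)])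
        then show ?thesis by (rule s)
      qed
      with s(1) show "\<exists>s>0. \<forall>A\<in>two_subsets X. \<forall>B\<in>two_subsets X.
        hausdorff_within d r A B \<longrightarrow> d (f A) (f B) \<le> s"
        by blast
    qed
  next
    assume R: ?R
    then have fA: "f A \<in> A" if "A \<in> two_subsets X" for A using that by blast
    then have fX: "f A \<in> X" if "A \<in> two_subsets X" for A
      using that unfolding two_subsets_def by blast
    show ?L
      unfolding two_selector_def macro_uniform_def
    proof (intro conjI ballI)
      show "f \<in> two_subsets X \<rightarrow> X" using fX by blast
      show "f A \<in> A" if "A \<in> two_subsets X" for A using that by (rule fA)
      fix D assume "D \<in> subspace_coarse (exp_coarse X (metric_coarse X d)) (two_subsets X)"
      then obtain E where E: "E \<in> metric_coarse X d" "D \<subseteq> exp_entourage X E"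
        "D \<subseteq> two_subsets X \<times> two_subsets X"
        unfolding subspace_coarse_def exp_coarse_def coarse_from_base_def by blast
      obtain r where r: "r > 0" "\<And>x y. (x, y) \<in> E \<Longrightarrow> d x y \<le> r"
        using E(1) unfolding metric_coarse_iff by blast
      obtain s where s: "s > 0" "\<And>A B. A \<in> two_subsets X \<Longrightarrow> B \<in> two_subsets X \<Longrightarrow>
          hausdorff_within d r A B \<Longrightarrow> d (f A) (f B) \<le> s"
        using conjunct2[OF R, rule_format, OF r(1)] by blast
      have close: "d (f A) (f B) \<le> s" if AB: "(A, B) \<in> D" for A B
      proof (rule s(2))
        show "A \<in> two_subsets X" "B \<in> two_subsets X" using AB E(3) by blast+
        have "A \<subseteq> E `` B" "B \<subseteq> E `` A"
          using AB E(2) unfolding exp_entourage_def by blast+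
        moreover have "d x y \<le> r" "d y x \<le> r" if "(x, y) \<in> E" for x y
          using r(2)[OF that] by (simp_all add: commute)
        ultimately show "hausdorff_within d r A B"
          unfolding hausdorff_within_def by blast
      qed
      show "\<exists>E'\<in>metric_coarse X d. \<forall>A\<in>two_subsets X. f ` (D `` {A}) \<subseteq> E' `` {f A}"
      proof (intro bexI[OF _ ball_entourage[OF assms s(1)]] ballI subsetI)
        fix A z assume "A \<in> two_subsets X" "z \<in> f ` (D `` {A})"
        then obtain B where "(A, B) \<in> D" "z = f B" by blast
        moreover from this have "f A \<in> X" "f B \<in> X" using fX E(3) by blast+
        ultimately show "z \<in> {(x, y). x \<in> X \<and> y \<in> X \<and> d x y \<le> s} `` {f A}"
          using close by simp
      qed
    qed
  qed
qed

lemma coarse_unbounded_metric: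
  assumes "Metric_space X d" "coarse_unbounded X (metric_coarse X d)" "p \<in> X"
  shows "\<exists>x\<in>X. d p x > r"
proof (rule ccontr)
  assume "\<not> ?thesis"
  then have "d p x \<le> max r 1" if "x \<in> X" for x
    using that by fastforce
  then have "X \<subseteq> {(x, y). x \<in> X \<and> y \<in> X \<and> d x y \<le> max r 1} `` {p}"
    using assms(3) by blast
  moreover have "{(x, y). x \<in> X \<and> y \<in> X \<and> d x y \<le> max r 1} \<in> metric_coarse X d"
    by (rule ball_entourage[OF assms(1)]) simp
  ultimately have "coarse_bounded X (metric_coarse X d) X"
    using assms(3) unfolding coarse_bounded_def by blast
  then show False using assms(2) by (simp add: coarse_unbounded_def)
qed

section \<open>Coarse equivalences with subsets of the real line\<close>

text \<open>
  \<open>h\<close> realises the model space as a set of reals, so that one argument serves \<open>\<nat>\<close> and \<open>\<int>\<close>.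
\<close>

lemma Metric_space_real_embedding:
  fixes h :: "'b \<Rightarrow> real"
  assumes "inj h" "\<And>a b. \<rho> a b = \<bar>h a - h b\<bar>"
  shows "Metric_space UNIV \<rho>"
  by (unfold_locales) (use assms in \<open>auto dest: injD\<close>)

lemma inj_real_of_int: "inj real_of_int"
  by (simp add: inj_def)

text \<open>
  Choosing a preimage under \<open>\<psi>\<close> of every point of the scaled model \<open>K * h\<close> yields a large subspace
  of \<open>X\<close>, on which dividing \<open>\<psi>\<close> by \<open>K\<close> is an asymorphism onto the whole model.
\<close>

lemma coarsely_equivalent_real_modelI:
  fixes h :: "'b \<Rightarrow> real"
  assumes X: "Metric_space X d"
    and h: "inj h" "\<And>a b. \<rho> a b = \<bar>h a - h b\<bar>"
    and upper: "\<And>x y. x \<in> X \<Longrightarrow> y \<in> X \<Longrightarrow> \<bar>\<psi> x - \<psi> y\<bar> \<le> d x y + C"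
    and lower: "\<And>x y. x \<in> X \<Longrightarrow> y \<in> X \<Longrightarrow> d x y \<le> \<bar>\<psi> x - \<psi> y\<bar> + C"
    and K: "K > 0"
    and hit: "\<And>a. \<exists>x\<in>X. \<psi> x = K * h a"
    and dense: "\<And>x. x \<in> X \<Longrightarrow> \<exists>a. \<bar>\<psi> x - K * h a\<bar> \<le> D"
  shows "coarsely_equivalent X (metric_coarse X d) UNIV (metric_coarse UNIV \<rho>)"
proof -
  interpret Metric_space X d by (rule X)
  have model: "Metric_space UNIV \<rho>" using h by (rule Metric_space_real_embedding)
  obtain y where yX: "\<And>a. y a \<in> X" and y: "\<And>a. \<psi> (y a) = K * h a"
    using hit by metis
  define Y where "Y = range y"
  have "Y \<subseteq> X" using yX unfolding Y_def by blast
  have Y: "Metric_space Y d" using \<open>Y \<subseteq> X\<close> by (rule subspace)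
  have "inj y"
  proof (rule injI)
    fix a b assume "y a = y b"
    then have "K * h a = K * h b" using y by metis
    then show "a = b" using K h(1) by (simp add: inj_eq)
  qed
  have \<psi>_diff: "\<bar>\<psi> (y a) - \<psi> (y b)\<bar> = K * \<rho> a b" for a b
    using K by (simp add: y h(2) abs_mult flip: right_diff_distrib)
  have C: "C \<ge> 0" using upper[OF yX yX, of undefined undefined] yX by simp
  have inv: "inv_into UNIV y (y a) = a" for a
    using \<open>inj y\<close> by simp

  have mu_inv: "macro_uniform Y (metric_coarse Y d) UNIV (metric_coarse UNIV \<rho>) (inv_into UNIV y)"
    unfolding macro_uniform_metric_iff[OF Y model]
  proof (intro conjI allI impI)
    fix r :: real assume r: "r > 0"
    have "\<rho> a b \<le> (r + C) / K" if "d (y a) (y b) \<le> r" for a b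
      using upper[OF yX yX, of a b] that K unfolding \<psi>_diff by (simp add: field_simps)
    moreover have "(r + C) / K > 0" using r C K by simp
    ultimately show "\<exists>s>0. \<forall>u\<in>Y. \<forall>v\<in>Y. d u v \<le> r \<longrightarrow>
        \<rho> (inv_into UNIV y u) (inv_into UNIV y v) \<le> s"
      unfolding Y_def by (auto simp: inv)
  qed auto
  have mu: "macro_uniform UNIV (metric_coarse UNIV \<rho>) Y (metric_coarse Y d) y"
    unfolding macro_uniform_metric_iff[OF model Y]
  proof (intro conjI allI impI)
    show "y \<in> UNIV \<rightarrow> Y" by (simp add: Y_def)
    fix r :: real assume r: "r > 0"
    have "d (y a) (y b) \<le> K * r + C" if "\<rho> a b \<le> r" for a b
      using lower[OF yX yX, of a b] mult_left_mono[OF that, of K] K unfolding \<psi>_diff by linarith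
    moreover have "K * r + C > 0" using r C K by (simp add: add_pos_nonneg)
    ultimately show "\<exists>s>0. \<forall>a\<in>UNIV. \<forall>b\<in>UNIV. \<rho> a b \<le> r \<longrightarrow> d (y a) (y b) \<le> s"
      by blast
  qed

  have bij: "bij_betw (inv_into UNIV y) Y UNIV"
    unfolding Y_def by (rule bij_betw_inv_into[OF inj_on_imp_bij_betw[OF \<open>inj y\<close>]])
  have "inv_into Y (inv_into UNIV y) a = y a" for a
    by (rule inv_into_f_eq) (use bij inv in \<open>auto simp: Y_def bij_betw_def\<close>)
  then have "inv_into Y (inv_into UNIV y) = y" by blast
  with mu mu_inv bij
  have asym: "asymorphism Y (metric_coarse Y d) UNIV (metric_coarse UNIV \<rho>) (inv_into UNIV y)"
    by (simp add: asymorphism_def)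

  have "large_subspace X (metric_coarse X d) Y"
  proof -
    let ?E = "{(x, y). x \<in> X \<and> y \<in> X \<and> d x y \<le> max (D + C) 1}"
    have E: "?E \<in> metric_coarse X d" by (rule ball_entourage[OF X]) simp
    have "x \<in> ?E `` Y" if x: "x \<in> X" for x
    proof -
      obtain a where "\<bar>\<psi> x - K * h a\<bar> \<le> D" using dense[OF x] by blast
      then have "d x (y a) \<le> D + C" using lower[OF x yX, of a] by (simp add: y)
      then have "(y a, x) \<in> ?E" using x yX by (simp add: commute)
      then show ?thesis by (auto simp: Y_def)
    qed
    then have "X = ?E `` Y" by blast
    then show ?thesis
      using E \<open>Y \<subseteq> X\<close> unfolding large_subspace_def by blast
  qed
  moreover have "large_subspace UNIV (metric_coarse UNIV \<rho>) UNIV"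
  proof -
    let ?E = "{(x, y). x \<in> UNIV \<and> y \<in> UNIV \<and> \<rho> x y \<le> 1}"
    have "?E \<in> metric_coarse UNIV \<rho>" by (rule ball_entourage[OF model]) simp
    moreover have "(a, a) \<in> ?E" for a by (simp add: h(2))
    then have "UNIV = ?E `` UNIV" by blast
    ultimately show ?thesis unfolding large_subspace_def by blast
  qed
  ultimately show ?thesis
    using asym unfolding coarsely_equivalent_def
    by (metis subspace_metric_coarse[OF X \<open>Y \<subseteq> X\<close>] subspace_metric_coarse[OF model subset_UNIV])
qed

text \<open>
  \<open>\<psi>\<close> is the composition of a map from \<open>X\<close> to its large subspace, which moves points by a bounded
  amount, with the asymorphism and \<open>h\<close>.
\<close>

lemma coarsely_equivalent_real_modelD:
  fixes h :: "'b \<Rightarrow> real"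
  assumes X: "Metric_space X d"
    and h: "inj h" "\<And>a b. \<rho> a b = \<bar>h a - h b\<bar>"
    and "coarsely_equivalent X (metric_coarse X d) UNIV (metric_coarse UNIV \<rho>)"
  obtains \<psi> :: "'a \<Rightarrow> real"
  where "\<And>r. r > 0 \<Longrightarrow> \<exists>s>0. \<forall>x\<in>X. \<forall>y\<in>X. d x y \<le> r \<longrightarrow> \<bar>\<psi> x - \<psi> y\<bar> \<le> s"
    and "\<And>r. r > 0 \<Longrightarrow> \<exists>s>0. \<forall>x\<in>X. \<forall>y\<in>X. \<bar>\<psi> x - \<psi> y\<bar> \<le> r \<longrightarrow> d x y \<le> s"
proof -
  interpret Metric_space X d by (rule X)
  have model: "Metric_space UNIV \<rho>" using h by (rule Metric_space_real_embedding)
  obtain Y Y' g where large: "large_subspace X (metric_coarse X d) Y"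
    and asym: "asymorphism Y (subspace_coarse (metric_coarse X d) Y)
                Y' (subspace_coarse (metric_coarse UNIV \<rho>) Y') g"
    using assms(4) unfolding coarsely_equivalent_def by blast
  have "Y \<subseteq> X" using large by (simp add: large_subspace_def)
  have Y: "Metric_space Y d" using \<open>Y \<subseteq> X\<close> by (rule subspace)
  have Y': "Metric_space Y' \<rho>" using model by (rule Metric_space.subspace) simp
  have bij: "bij_betw g Y Y'"
    and g: "\<And>r. r > 0 \<Longrightarrow> \<exists>s>0. \<forall>x\<in>Y. \<forall>y\<in>Y. d x y \<le> r \<longrightarrow> \<rho> (g x) (g y) \<le> s"
    and g': "\<And>r. r > 0 \<Longrightarrow> \<exists>s>0. \<forall>a\<in>Y'. \<forall>b\<in>Y'. \<rho> a b \<le> r \<longrightarrow>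
                 d (inv_into Y g a) (inv_into Y g b) \<le> s"
    using asym
    unfolding asymorphism_def subspace_metric_coarse[OF X \<open>Y \<subseteq> X\<close>]
      subspace_metric_coarse[OF model subset_UNIV]
      macro_uniform_metric_iff[OF Y Y'] macro_uniform_metric_iff[OF Y' Y]
    by blast+
  obtain E where E: "E \<in> metric_coarse X d" "X = E `` Y"
    using large unfolding large_subspace_def by blast
  obtain D where D: "D > 0" "\<And>x y. (x, y) \<in> E \<Longrightarrow> d x y \<le> D"
    using E(1) unfolding metric_coarse_iff by blast
  have "\<exists>y\<in>Y. d y x \<le> D" if "x \<in> X" for x
    using that E(2) D(2) by blast
  then obtain q where q: "\<And>x. x \<in> X \<Longrightarrow> q x \<in> Y" "\<And>x. x \<in> X \<Longrightarrow> d (q x) x \<le> D"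
    by metis
  have qX: "q x \<in> X" if "x \<in> X" for x using q(1)[OF that] \<open>Y \<subseteq> X\<close> by blast
  have moved: "\<bar>d (q x) (q y) - d x y\<bar> \<le> 2 * D" if "x \<in> X" "y \<in> X" for x y
    using triangle[of "q x" x "q y"] triangle[of x y "q y"] triangle[of x "q x" y]
      triangle[of "q x" "q y" y] q(2)[of x] q(2)[of y] qX[of x] qX[of y] that commute
    by (smt (verit))
  show thesis
  proof (rule that)
    fix r :: real assume r: "r > 0"
    then obtain s where s: "s > 0" "\<And>x y. x \<in> Y \<Longrightarrow> y \<in> Y \<Longrightarrow> d x y \<le> r + 2 * D \<Longrightarrow> \<rho> (g x) (g y) \<le> s"
      using g[of "r + 2 * D"] D(1) by (smt (verit))
    have "\<bar>h (g (q x)) - h (g (q y))\<bar> \<le> s" if "x \<in> X" "y \<in> X" "d x y \<le> r" for x y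
      using s(2)[of "q x" "q y"] q(1) moved[of x y] that unfolding h(2) by (simp add: abs_le_iff)
    with s(1) show "\<exists>s>0. \<forall>x\<in>X. \<forall>y\<in>X. d x y \<le> r \<longrightarrow> \<bar>h (g (q x)) - h (g (q y))\<bar> \<le> s"
      by blast
  next
    fix r :: real assume r: "r > 0"
    then obtain s where s: "s > 0" "\<And>a b. a \<in> Y' \<Longrightarrow> b \<in> Y' \<Longrightarrow> \<rho> a b \<le> r \<Longrightarrow>
        d (inv_into Y g a) (inv_into Y g b) \<le> s"
      using g' by meson
    have "d x y \<le> s + 2 * D" if xy: "x \<in> X" "y \<in> X" "\<bar>h (g (q x)) - h (g (q y))\<bar> \<le> r" for x y
    proof -
      have "g (q x) \<in> Y'" "g (q y) \<in> Y'" using bij q(1) xy by (auto simp: bij_betw_def)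
      moreover have "inv_into Y g (g (q u)) = q u" if "u \<in> X" for u
        using bij q(1)[OF that] by (simp add: bij_betw_def)
      ultimately have "d (q x) (q y) \<le> s"
        using s(2)[of "g (q x)" "g (q y)"] xy unfolding h(2) by simp
      then show ?thesis using moved[OF xy(1,2)] by (simp add: abs_le_iff)
    qed
    moreover have "s + 2 * D > 0" using s(1) D(1) by simp
    ultimately show "\<exists>s>0. \<forall>x\<in>X. \<forall>y\<in>X. \<bar>h (g (q x)) - h (g (q y))\<bar> \<le> r \<longrightarrow> d x y \<le> s"
      by blast
  qed
qed

text \<open>
  The selector takes the point of smaller \<open>\<psi>\<close>-value.  Points selected from two close pairs have close
  \<open>\<psi>\<close>-values, since a minimum is stable under small changes of the set, even when the two
  values in a pair nearly agree and the selection is unstable.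
\<close>

lemma two_selector_of_coarse_embedding:
  fixes \<psi> :: "'a \<Rightarrow> real"
  assumes X: "Metric_space X d"
    and up: "\<And>r. r > 0 \<Longrightarrow> \<exists>s>0. \<forall>x\<in>X. \<forall>y\<in>X. d x y \<le> r \<longrightarrow> \<bar>\<psi> x - \<psi> y\<bar> \<le> s"
    and low: "\<And>r. r > 0 \<Longrightarrow> \<exists>s>0. \<forall>x\<in>X. \<forall>y\<in>X. \<bar>\<psi> x - \<psi> y\<bar> \<le> r \<longrightarrow> d x y \<le> s"
  shows "\<exists>f. two_selector X (metric_coarse X d) f"
proof -
  let ?f = "\<lambda>A. arg_min_on \<psi> A"
  have fin: "finite A" "A \<noteq> {}" "A \<subseteq> X" if "A \<in> two_subsets X" for A
    using that card_ge_0_finite[of A] by (auto simp: two_subsets_def)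
  have mem: "?f A \<in> A" and least: "\<And>a. a \<in> A \<Longrightarrow> \<psi> (?f A) \<le> \<psi> a"
    if "A \<in> two_subsets X" for A
    using arg_min_if_finite(1)[OF fin(1,2)[OF that], of \<psi>]
      arg_min_least[OF fin(1,2)[OF that], of _ \<psi>] by blast+
  have "two_selector X (metric_coarse X d) ?f"
    unfolding two_selector_metric_iff[OF X]
  proof (intro conjI allI impI ballI)
    show "?f A \<in> A" if "A \<in> two_subsets X" for A using that by (rule mem)
    fix r :: real assume "r > 0"
    then obtain s where s: "s > 0" "\<And>x y. x \<in> X \<Longrightarrow> y \<in> X \<Longrightarrow> d x y \<le> r \<Longrightarrow> \<bar>\<psi> x - \<psi> y\<bar> \<le> s"
      using up by meson
    then obtain t where t: "t > 0" "\<And>x y. x \<in> X \<Longrightarrow> y \<in> X \<Longrightarrow> \<bar>\<psi> x - \<psi> y\<bar> \<le> s \<Longrightarrow> d x y \<le> t"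
      using low by meson
    have "d (?f A) (?f B) \<le> t"
      if AB: "A \<in> two_subsets X" "B \<in> two_subsets X"
        and close: "hausdorff_within d r A B" for A B
    proof (rule t(2))
      have ab: "\<forall>a\<in>A. \<exists>b\<in>B. d a b \<le> r" and ba: "\<forall>b\<in>B. \<exists>a\<in>A. d a b \<le> r"
        using close unfolding hausdorff_within_def by blast+
      show inX: "?f A \<in> X" "?f B \<in> X" using mem fin(3) AB by blast+
      obtain b where b: "b \<in> B" "d (?f A) b \<le> r" using ab mem[OF AB(1)] by blast
      obtain a where a: "a \<in> A" "d a (?f B) \<le> r" using ba mem[OF AB(2)] by blast
      have "a \<in> X" "b \<in> X" using a b AB fin(3) by blast+
      then have "\<bar>\<psi> (?f A) - \<psi> b\<bar> \<le> s" "\<bar>\<psi> a - \<psi> (?f B)\<bar> \<le> s"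
        using s(2) a b inX by blast+
      with least[OF AB(1) a(1)] least[OF AB(2) b(1)]
      show "\<bar>\<psi> (?f A) - \<psi> (?f B)\<bar> \<le> s" by linarith
    qed
    with t(1) show "\<exists>t>0. \<forall>A\<in>two_subsets X. \<forall>B\<in>two_subsets X.
        hausdorff_within d r A B \<longrightarrow> d (?f A) (?f B) \<le> t"
      by blast
  qed
  then show ?thesis by blast
qed

lemma two_selector_if_coarsely_equivalent:
  assumes "Metric_space X d"
    and "coarsely_equivalent X (metric_coarse X d) UNIV nat_coarse \<or>
         coarsely_equivalent X (metric_coarse X d) UNIV int_coarse"
  shows "\<exists>f. two_selector X (metric_coarse X d) f"
  using assms(2)
proof
  assume "coarsely_equivalent X (metric_coarse X d) UNIV nat_coarse"
  from coarsely_equivalent_real_modelD[OF assms(1) inj_of_nat path_metric_nat this]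
  show ?thesis using two_selector_of_coarse_embedding[OF assms(1)] by blast
next
  assume "coarsely_equivalent X (metric_coarse X d) UNIV int_coarse"
  from coarsely_equivalent_real_modelD[OF assms(1) inj_real_of_int path_metric_int this]
  show ?thesis using two_selector_of_coarse_embedding[OF assms(1)] by blast
qed

section \<open>Coarse tournaments on geodesic spaces\<close>

text \<open>
  The common feature of 2-selectors and compatible orders: a tournament in which
  comparison with \<open>y\<close> can change along a chain of short steps only near \<open>y\<close>.
\<close>

locale coarse_tournament = Metric_space X d
  for X :: "'a set" and d :: "'a \<Rightarrow> 'a \<Rightarrow> real" +
  fixes lt :: "'a \<Rightarrow> 'a \<Rightarrow> bool" and s :: real
  assumes geodesic: "geodesic_metric X d"
    and s_nonneg: "s \<ge> 0"
    and total: "x \<in> X \<Longrightarrow> y \<in> X \<Longrightarrow> x \<noteq> y \<Longrightarrow> lt x y \<or> lt y x"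
    and asym: "x \<in> X \<Longrightarrow> y \<in> X \<Longrightarrow> lt x y \<Longrightarrow> \<not> lt y x"
    and step: "x \<in> X \<Longrightarrow> x' \<in> X \<Longrightarrow> y \<in> X \<Longrightarrow> d x x' \<le> 1 \<Longrightarrow> d x y > s \<Longrightarrow> d x' y > s \<Longrightarrow>
                 lt x y \<Longrightarrow> lt x' y"
begin

lemma reverse: "coarse_tournament X d (\<lambda>x y. lt y x) s"
proof unfold_locales
  fix x x' y assume "x \<in> X" "x' \<in> X" "y \<in> X" "d x x' \<le> 1" "d x y > s" "d x' y > s" "lt y x"
  moreover from this have "x' \<noteq> y" using s_nonneg by auto
  moreover have "d x' x \<le> 1" using calculation by (simp add: commute)
  ultimately show "lt y x'" using total[of x' y] step[of x' x y] asym by blast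
qed (use geodesic s_nonneg total asym in blast)+

text \<open>
  A geodesic from \<open>x\<close> to \<open>z\<close> must enter the ball of radius \<open>s\<close> around \<open>y\<close>: otherwise steps of
  length at most 1 along it would carry \<open>x < y\<close> to \<open>z < y\<close>.  The detour through \<open>y\<close> from a point of the
  geodesic in that ball costs at most \<open>2 * s\<close>.
\<close>

lemma crossing:
  assumes X: "x \<in> X" "y \<in> X" "z \<in> X" and "lt x y" "lt y z"
  shows "d x y + d y z \<le> d x z + 2 * s"
proof (rule ccontr)
  assume neg: "\<not> ?thesis"
  define L where "L = d x z"
  have L: "L \<ge> 0" by (simp add: L_def)
  obtain \<gamma> where \<gamma>: "\<gamma> \<in> {0..L} \<rightarrow> X" "\<gamma> 0 = x" "\<gamma> L = z"
    and iso: "\<And>t u. t \<in> {0..L} \<Longrightarrow> u \<in> {0..L} \<Longrightarrow> d (\<gamma> t) (\<gamma> u) = \<bar>t - u\<bar>"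
    using geodesic X unfolding geodesic_metric_def L_def by meson
  have far: "d (\<gamma> t) y > s" if t: "t \<in> {0..L}" for t
  proof -
    have "\<gamma> t \<in> X" using \<gamma>(1) t by blast
    moreover have "d x (\<gamma> t) = t" "d (\<gamma> t) z = L - t"
      using iso[of 0 t] iso[of t L] t L \<gamma> by auto
    ultimately show ?thesis
      using triangle[of x "\<gamma> t" y] triangle[of y "\<gamma> t" z] commute[of y "\<gamma> t"] X neg
      by (simp add: L_def)
  qed
  have "lt (\<gamma> (min (real n) L)) y" for n
  proof (induction n)
    case 0
    then show ?case using L \<gamma> \<open>lt x y\<close> by simp
  next
    case (Suc n)
    let ?t = "min (real n) L" and ?u = "min (real (Suc n)) L"
    have tu: "?t \<in> {0..L}" "?u \<in> {0..L}" using L by auto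
    moreover have "d (\<gamma> ?t) (\<gamma> ?u) \<le> 1" using iso[OF tu] by (auto simp: min_def)
    ultimately show ?case using step[OF _ _ X(2)] \<gamma>(1) far Suc by blast
  qed
  moreover obtain n where "real n \<ge> L" using real_arch_simple by blast
  ultimately have "lt z y" using \<gamma>(3) by (metis min.absorb2)
  then show False using asym X \<open>lt y z\<close> by blast
qed

definition signed_dist :: "'a \<Rightarrow> 'a \<Rightarrow> real" where
  "signed_dist p x = (if lt p x then d p x else - d p x)"

lemma abs_signed_dist: "\<bar>signed_dist p x\<bar> = d p x"
  by (simp add: signed_dist_def)

text \<open>
  Only points on different sides of \<open>p\<close> matter here: a geodesic between them crosses at \<open>p\<close>.
\<close>

lemma signed_dist_upper:
  assumes "p \<in> X" "x \<in> X" "y \<in> X"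
  shows "\<bar>signed_dist p x - signed_dist p y\<bar> \<le> d x y + 2 * s"
proof -
  have tri: "\<bar>d p x - d p y\<bar> \<le> d x y"
    using triangle[of p x y] triangle[of p y x] assms by (simp add: commute)
  have opp: "d p u + d p v \<le> d u v + 2 * s" if "u \<in> X" "v \<in> X" "lt p u" "\<not> lt p v" for u v
  proof (cases "v = p")
    case False
    then have "lt v p" using total assms that by blast
    then show ?thesis using crossing[of v p u] that assms by (simp add: commute)
  qed (use s_nonneg assms that in \<open>simp add: commute\<close>)
  show ?thesis
    using tri opp[of x y] opp[of y x] commute[of y x] nonneg[of p x] nonneg[of p y] assms s_nonneg
    unfolding signed_dist_def by (smt (verit))
qed

text \<open>
  Only points on the same side of \<open>p\<close> matter here.  The tournament compares them with each other, and
  the one between \<open>p\<close> and the other is a crossing point.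
\<close>

lemma signed_dist_lower:
  assumes "p \<in> X" "x \<in> X" "y \<in> X"
  shows "d x y \<le> \<bar>signed_dist p x - signed_dist p y\<bar> + 2 * s"
proof -
  have tri: "d x y \<le> d p x + d p y"
    using triangle[of x p y] assms by (simp add: commute)
  have above: "d u v \<le> \<bar>d p u - d p v\<bar> + 2 * s"
    if "u \<in> X" "v \<in> X" "lt p u" "lt p v" for u v
  proof (cases "u = v")
    case False
    then have "lt u v \<or> lt v u" using total that by blast
    then show ?thesis using crossing[of p u v] crossing[of p v u] that assms by (auto simp: commute)
  qed (use s_nonneg that in simp)
  have below: "d u v \<le> \<bar>d p u - d p v\<bar> + 2 * s"
    if "u \<in> X" "v \<in> X" "\<not> lt p u" "\<not> lt p v" for u v
  proof (cases "u = v \<or> u = p \<or> v = p")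
    case True
    then show ?thesis using s_nonneg that assms by (auto simp: commute)
  next
    case False
    then have "lt u p" "lt v p" "lt u v \<or> lt v u" using total that assms by blast+
    then show ?thesis using crossing[of u v p] crossing[of v u p] that assms by (auto simp: commute)
  qed
  show ?thesis
    using tri above[of x y] below[of x y] assms s_nonneg by (auto simp: signed_dist_def)
qed

text \<open>
  The point at distance \<open>t\<close> from \<open>p\<close> on a geodesic to a point \<open>x\<close> above \<open>p\<close> is itself above \<open>p\<close>:
  otherwise crossing at \<open>p\<close>, on the way from that point to \<open>x\<close>, would give
  \<open>t + d p x \<le> (d p x - t) + 2 * s\<close>, that is \<open>t \<le> s\<close>.
\<close>

lemma signed_dist_attains:
  assumes "p \<in> X" "x \<in> X" "lt p x" "s < t" "t \<le> d p x"
  shows "\<exists>q\<in>X. signed_dist p q = t"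
proof -
  obtain \<gamma> where \<gamma>: "\<gamma> \<in> {0..d p x} \<rightarrow> X" "\<gamma> 0 = p" "\<gamma> (d p x) = x"
    and iso: "\<And>t u. t \<in> {0..d p x} \<Longrightarrow> u \<in> {0..d p x} \<Longrightarrow> d (\<gamma> t) (\<gamma> u) = \<bar>t - u\<bar>"
    using geodesic assms(1,2) unfolding geodesic_metric_def by meson
  have t: "t \<in> {0..d p x}" "t > 0" using assms s_nonneg by auto
  then have q: "\<gamma> t \<in> X" using \<gamma>(1) by blast
  have dist: "d p (\<gamma> t) = t" "d (\<gamma> t) x = d p x - t"
    using iso[of 0 t] iso[of t "d p x"] t \<gamma> by auto
  have "\<not> lt (\<gamma> t) p"
    using crossing[of "\<gamma> t" p x] q assms dist by (auto simp: commute)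
  moreover have "\<gamma> t \<noteq> p" using dist t assms(1) by auto
  ultimately have "lt p (\<gamma> t)" using total q assms(1) by blast
  then have "signed_dist p (\<gamma> t) = t" by (simp add: signed_dist_def dist)
  with q show ?thesis by blast
qed

lemma signed_dist_reverse:
  assumes "p \<in> X" "x \<in> X"
  shows "coarse_tournament.signed_dist d (\<lambda>x y. lt y x) p x = - signed_dist p x"
proof -
  interpret rev: coarse_tournament X d "\<lambda>x y. lt y x" s by (rule reverse)
  show ?thesis
    using total[OF assms] asym[OF assms] assms
    by (cases "x = p") (auto simp: signed_dist_def rev.signed_dist_def)
qed

text \<open>
  The spacing \<open>s + 1\<close> of the chosen points exceeds \<open>s\<close>, so that signed distances equal to its
  nonzero multiples are attained.
\<close>

lemma coarsely_equivalent_nat_if_bounded_below: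
  assumes p: "p \<in> X"
    and up: "\<And>r. \<exists>x\<in>X. lt p x \<and> d p x > r"
    and bdd: "\<And>x. x \<in> X \<Longrightarrow> lt x p \<Longrightarrow> d p x \<le> b"
  shows "coarsely_equivalent X (metric_coarse X d) UNIV nat_coarse"
proof (rule coarsely_equivalent_real_modelI[OF Metric_space_axioms inj_of_nat path_metric_nat
      signed_dist_upper[OF p] signed_dist_lower[OF p]])
  show K: "s + 1 > 0" using s_nonneg by simp
  show "\<exists>x\<in>X. signed_dist p x = (s + 1) * real n" for n
  proof (cases "n = 0")
    case True
    then show ?thesis using p by (intro bexI[of _ p]) (auto simp: signed_dist_def)
  next
    case False
    obtain x where x: "x \<in> X" "lt p x" "d p x > (s + 1) * real n" using up by blast
    have "(s + 1) * 1 \<le> (s + 1) * real n" using False K by (intro mult_left_mono) auto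
    then show ?thesis using signed_dist_attains[OF p x(1,2)] x(3) by simp
  qed
  show "\<exists>n. \<bar>signed_dist p x - (s + 1) * real n\<bar> \<le> max b (s + 1)" if x: "x \<in> X" for x
  proof (cases "signed_dist p x \<ge> 0")
    case True
    define n where "n = nat \<lfloor>signed_dist p x / (s + 1)\<rfloor>"
    have "real n = of_int \<lfloor>signed_dist p x / (s + 1)\<rfloor>" using True K by (simp add: n_def)
    then have "real n \<le> signed_dist p x / (s + 1)" "signed_dist p x / (s + 1) < real n + 1"
      by linarith+
    then have "(s + 1) * real n \<le> signed_dist p x" "signed_dist p x \<le> (s + 1) * real n + (s + 1)"
      using K by (simp_all add: field_simps)
    then show ?thesis by (intro exI[of _ n]) auto
  next
    case False
    then have "\<not> lt p x" "x \<noteq> p" using p by (auto simp: signed_dist_def split: if_splits)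
    then have "d p x \<le> b" using bdd total x p by blast
    then show ?thesis using abs_signed_dist[of p x] by (intro exI[of _ 0]) auto
  qed
qed

lemma coarsely_equivalent_int_if_unbounded:
  assumes p: "p \<in> X"
    and up: "\<And>r. \<exists>x\<in>X. lt p x \<and> d p x > r"
    and down: "\<And>r. \<exists>x\<in>X. lt x p \<and> d p x > r"
  shows "coarsely_equivalent X (metric_coarse X d) UNIV int_coarse"
proof (rule coarsely_equivalent_real_modelI[OF Metric_space_axioms inj_real_of_int path_metric_int
      signed_dist_upper[OF p] signed_dist_lower[OF p]])
  interpret rev: coarse_tournament X d "\<lambda>x y. lt y x" s by (rule reverse)
  show K: "s + 1 > 0" using s_nonneg by simp
  show "\<exists>x\<in>X. signed_dist p x = (s + 1) * of_int n" for n
  proof (cases n "0 :: int" rule: linorder_cases)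
    case equal
    then show ?thesis using p by (intro bexI[of _ p]) (auto simp: signed_dist_def)
  next
    case greater
    obtain x where x: "x \<in> X" "lt p x" "d p x > (s + 1) * of_int n" using up by blast
    have "(s + 1) * 1 \<le> (s + 1) * of_int n" using greater K by (intro mult_left_mono) auto
    then show ?thesis using signed_dist_attains[OF p x(1,2)] x(3) by simp
  next
    case less
    \<comment> \<open>The reversed tournament negates signed distances, so its positive values are needed.\<close>
    obtain x where x: "x \<in> X" "lt x p" "d p x > (s + 1) * of_int (- n)" using down by blast
    have "(s + 1) * 1 \<le> (s + 1) * of_int (- n)" using less K by (intro mult_left_mono) auto
    then obtain q where "q \<in> X" "rev.signed_dist p q = (s + 1) * of_int (- n)"
      using rev.signed_dist_attains[OF p x(1,2), of "(s + 1) * of_int (- n)"] x(3) by auto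
    then show ?thesis using signed_dist_reverse[OF p] by (intro bexI[of _ q]) auto
  qed
  show "\<exists>n. \<bar>signed_dist p x - (s + 1) * of_int n\<bar> \<le> s + 1" if x: "x \<in> X" for x
  proof -
    define n where "n = \<lfloor>signed_dist p x / (s + 1)\<rfloor>"
    have "of_int n \<le> signed_dist p x / (s + 1)" "signed_dist p x / (s + 1) < of_int n + 1"
      unfolding n_def by linarith+
    then have "(s + 1) * of_int n \<le> signed_dist p x"
      "signed_dist p x \<le> (s + 1) * of_int n + (s + 1)"
      using K by (simp_all add: field_simps)
    then show ?thesis by (intro exI[of _ n]) auto
  qed
qed

theorem coarsely_equivalent_nat_or_int:
  assumes "X \<noteq> {}" "coarse_unbounded X (metric_coarse X d)"
  shows "coarsely_equivalent X (metric_coarse X d) UNIV nat_coarse \<or>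
         coarsely_equivalent X (metric_coarse X d) UNIV int_coarse"
proof -
  interpret rev: coarse_tournament X d "\<lambda>x y. lt y x" s by (rule reverse)
  obtain p where p: "p \<in> X" using assms(1) by blast
  let ?up = "\<forall>r. \<exists>x\<in>X. lt p x \<and> d p x > r" and ?down = "\<forall>r. \<exists>x\<in>X. lt x p \<and> d p x > r"
  consider "?up" "?down" | "?up" "\<not> ?down" | "\<not> ?up" "?down" | "\<not> ?up" "\<not> ?down" by blast
  then show ?thesis
  proof cases
    case 1
    then show ?thesis using coarsely_equivalent_int_if_unbounded[OF p] by blast
  next
    case 2
    then show ?thesis using coarsely_equivalent_nat_if_bounded_below[OF p] by (meson not_less)
  next
    case 3
    then show ?thesis using rev.coarsely_equivalent_nat_if_bounded_below[OF p] by (meson not_less)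
  next
    case 4
    then obtain a b where ab: "\<And>x. x \<in> X \<Longrightarrow> lt p x \<Longrightarrow> d p x \<le> a"
      "\<And>x. x \<in> X \<Longrightarrow> lt x p \<Longrightarrow> d p x \<le> b"
      by (meson not_less)
    obtain x where x: "x \<in> X" "d p x > max 0 (max a b)"
      using coarse_unbounded_metric[OF Metric_space_axioms assms(2) p] by blast
    then have "x \<noteq> p" using p by auto
    then show ?thesis using ab[OF x(1)] total[OF p x(1)] x(2) by fastforce
  qed
qed

end

section \<open>Tournaments from selectors and from compatible orders\<close>

text \<open>
  If moving \<open>x\<close> to \<open>x'\<close> changes the choice from \<open>x\<close> to \<open>y\<close>, then the pairs \<open>{x, y}\<close> and \<open>{x', y}\<close>
  are close while their selected points are \<open>d x y\<close> apart, so \<open>y\<close> is near \<open>x\<close>.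
\<close>

lemma coarse_tournament_if_two_selector:
  assumes X: "Metric_space X d" and geodesic: "geodesic_metric X d"
    and f: "two_selector X (metric_coarse X d) f"
  shows "\<exists>s. coarse_tournament X d (\<lambda>x y. x \<noteq> y \<and> f {x, y} = x) s"
proof -
  interpret Metric_space X d by (rule X)
  have two: "{x, y} \<in> two_subsets X" if "x \<in> X" "y \<in> X" "x \<noteq> y" for x y
    using that by (simp add: two_subsets_def)
  have "\<forall>A\<in>two_subsets X. f A \<in> A" using f by (simp add: two_selector_def)
  then have mem: "f {x, y} = x \<or> f {x, y} = y" if "x \<in> X" "y \<in> X" "x \<noteq> y" for x y
    using two[OF that] by fastforce
  obtain s where s: "s > 0" "\<And>A B. A \<in> two_subsets X \<Longrightarrow> B \<in> two_subsets X \<Longrightarrow>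
      hausdorff_within d 1 A B \<Longrightarrow> d (f A) (f B) \<le> s"
    using f unfolding two_selector_metric_iff[OF X] by (metis zero_less_one)
  have "coarse_tournament X d (\<lambda>x y. x \<noteq> y \<and> f {x, y} = x) s"
  proof unfold_locales
    show "geodesic_metric X d" by (rule geodesic)
    show "s \<ge> 0" using s(1) by simp
    show "(x \<noteq> y \<and> f {x, y} = x) \<or> (y \<noteq> x \<and> f {y, x} = y)"
      if "x \<in> X" "y \<in> X" "x \<noteq> y" for x y
      using mem[OF that] that by (auto simp: insert_commute)
    show "\<not> (y \<noteq> x \<and> f {y, x} = y)" if "x \<noteq> y \<and> f {x, y} = x" for x y
      using that by (auto simp: insert_commute)
    fix x x' y
    assume xy: "x \<in> X" "x' \<in> X" "y \<in> X" "d x x' \<le> 1" "d x y > s" "d x' y > s"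
      "x \<noteq> y \<and> f {x, y} = x"
    then have "x' \<noteq> y" using s(1) by auto
    have "d (f {x, y}) (f {x', y}) \<le> s"
      using s(2)[OF two two, of x y x' y] xy \<open>x' \<noteq> y\<close> by (auto simp: hausdorff_within_def)
    then have "f {x', y} \<noteq> y" using xy by auto
    then show "x' \<noteq> y \<and> f {x', y} = x'" using mem[of x' y] xy \<open>x' \<noteq> y\<close> by blast
  qed
  then show ?thesis by blast
qed

text \<open>
  The entourage \<open>F\<close> that compatibility assigns to the steps of length at most 1 lies in
  \<open>{(x, y). d x y \<le> s}\<close> for some \<open>s\<close>, so a distance above \<open>s\<close> puts \<open>y\<close> outside \<open>F[x]\<close>.
\<close>

lemma coarse_tournament_if_compatible_order:
  assumes X: "Metric_space X d" and geodesic: "geodesic_metric X d"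
    and R: "compatible_order X (metric_coarse X d) R"
  shows "\<exists>s. coarse_tournament X d (\<lambda>x y. (x, y) \<in> R - Id) s"
proof -
  interpret Metric_space X d by (rule X)
  let ?E = "{(x, y). x \<in> X \<and> y \<in> X \<and> d x y \<le> 1}"
  have lin: "linear_order_on X R" using R by (simp add: compatible_order_def)
  have "?E \<in> metric_coarse X d" by (rule ball_entourage[OF X]) simp
  then obtain F where F: "F \<in> metric_coarse X d"
    and stable: "\<And>x y x'. x \<in> X \<Longrightarrow> y \<in> X - F `` {x} \<Longrightarrow> (x, y) \<in> R - Id \<Longrightarrow> x' \<in> ?E `` {x} \<Longrightarrow>
                    (x', y) \<in> R - Id"
    using R unfolding compatible_order_def by (metis (no_types, lifting) DiffD1 DiffD2 pair_in_Id_conv)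
  obtain s where s: "s > 0" "\<And>x y. (x, y) \<in> F \<Longrightarrow> d x y \<le> s"
    using F unfolding metric_coarse_iff by blast
  have "coarse_tournament X d (\<lambda>x y. (x, y) \<in> R - Id) s"
  proof unfold_locales
    show "geodesic_metric X d" by (rule geodesic)
    show "s \<ge> 0" using s(1) by simp
    show "(x, y) \<in> R - Id \<or> (y, x) \<in> R - Id" if "x \<in> X" "y \<in> X" "x \<noteq> y" for x y
      using lin that unfolding linear_order_on_def total_on_def by blast
    show "(y, x) \<notin> R - Id" if "(x, y) \<in> R - Id" for x y
      using lin that
      unfolding linear_order_on_def partial_order_on_def by (auto dest: antisymD)
    fix x x' y
    assume xy: "x \<in> X" "x' \<in> X" "y \<in> X" "d x x' \<le> 1" "d x y > s" "(x, y) \<in> R - Id"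
    then have "y \<in> X - F `` {x}" using s(2) by fastforce
    then show "(x', y) \<in> R - Id" using stable[of x y x'] xy by blast
  qed
  then show ?thesis by blast
qed

theorem theorem2:
  fixes X :: "'a set" and d :: "'a \<Rightarrow> 'a \<Rightarrow> real"
  assumes "Metric_space X d"
    and "X \<noteq> {}"
    and "geodesic_metric X d"
    and "coarse_unbounded X (metric_coarse X d)"
  shows "((\<exists>f. two_selector X (metric_coarse X d) f) \<longleftrightarrow>
            coarsely_equivalent X (metric_coarse X d) UNIV nat_coarse \<or>
            coarsely_equivalent X (metric_coarse X d) UNIV int_coarse) \<and>
         ((\<exists>R. compatible_order X (metric_coarse X d) R) \<longrightarrow>
            coarsely_equivalent X (metric_coarse X d) UNIV nat_coarse \<or>
            coarsely_equivalent X (metric_coarse X d) UNIV int_coarse)"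
  using two_selector_if_coarsely_equivalent[OF assms(1)]
    coarse_tournament_if_two_selector[OF assms(1,3)]
    coarse_tournament_if_compatible_order[OF assms(1,3)]
    coarse_tournament.coarsely_equivalent_nat_or_int[OF _ assms(2,4)]
  by meson

end
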